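(* Let $X$ be a set and let $\kappa,\sigma\in\mathcal{K}^+(X)$. Then $\widehat S(\kappa,\sigma)\preccurlyeq_R\sigma$, i.e. $\widehat S(\kappa,\sigma)(x,z)\le\widehat S(\kappa,\sigma)(x,y)+\sigma(y,z)$ for all $x,y,z\in X$.
   Context: $\mathcal{K}^+(X)$ is the set of functions $\kappa:X\times X\to\mathbb{R}$ with $\kappa\ge0$. A kernel $\kappa$ is right dominated by a kernel $\sigma$, written $\kappa\preccurlyeq_R\sigma$, if $\kappa(x,z)\le\kappa(x,y)+\sigma(y,z)$ for all $x,y,z\in X$. Let $X_\infty=\coprod_{n\ge0}X^n$ with $X^0=\{\emptyset\}$. For $\kappa,\sigma\in\mathcal{K}^+(X)$, $x,y\in X$ and $p\in X_\infty$ define $$S(\kappa,\sigma)(x,p,y)=\begin{cases}\kappa(x,y),& p=\emptyset,\\ \kappa(x,x_1)+\sigma(x_1,y),& p=(x_1),\\ \kappa(x,x_1)+\sum_{i=1}^{n-1}\sigma(x_i,x_{i+1})+\sigma(x_n,y),& p=(x_1,\dots,x_n),\ n\ge2,\end{cases}$$ and $\widehat S(\kappa,\sigma)(x,y)=\inf\{S(\kappa,\sigma)(x,p,y):p\in X_\infty\}$. *)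

theory Defs
  imports Complex_Main
begin

text \<open>
  The underlying set is a carrier \<open>X :: 'a set\<close> (possibly empty). A kernel on \<open>X\<close> is a
  curried function; its values outside \<open>X \<times> X\<close> are irrelevant.
\<close>

definition nonneg_kernels :: "'a set \<Rightarrow> ('a \<Rightarrow> 'a \<Rightarrow> real) set" where
  "nonneg_kernels X = {\<kappa>. \<forall>x\<in>X. \<forall>y\<in>X. 0 \<le> \<kappa> x y}"

definition right_dominated :: "'a set \<Rightarrow> ('a \<Rightarrow> 'a \<Rightarrow> real) \<Rightarrow> ('a \<Rightarrow> 'a \<Rightarrow> real) \<Rightarrow> bool" where
  "right_dominated X \<kappa> \<sigma> \<longleftrightarrow>
     (\<forall>x\<in>X. \<forall>y\<in>X. \<forall>z\<in>X. \<kappa> x z \<le> \<kappa> x y + \<sigma> y z)"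

text \<open>
  The disjoint union of the powers \<open>X\<^sup>n\<close>, \<open>n \<ge> 0\<close>, is \<open>lists X\<close>. In the second equation
  \<open>p = x\<^sub>1 # q\<close> has length \<open>n \<ge> 1\<close> and \<open>p ! i\<close> is the entry \<open>x\<^bsub>i+1\<^esub>\<close>; the middle
  sum has \<open>n - 1\<close> terms, hence is empty for \<open>n = 1\<close>.
\<close>

fun path_sum ::
  "('a \<Rightarrow> 'a \<Rightarrow> real) \<Rightarrow> ('a \<Rightarrow> 'a \<Rightarrow> real) \<Rightarrow> 'a \<Rightarrow> 'a list \<Rightarrow> 'a \<Rightarrow> real" where
  "path_sum \<kappa> \<sigma> x [] y = \<kappa> x y"
| "path_sum \<kappa> \<sigma> x (x\<^sub>1 # q) y =
     (let p = x\<^sub>1 # q in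
       \<kappa> x x\<^sub>1 + (\<Sum>i<length p - 1. \<sigma> (p ! i) (p ! Suc i)) + \<sigma> (last p) y)"

text \<open>
  For nonnegative kernels on \<open>X\<close> and \<open>x, y \<in> X\<close> the set of path sums is nonempty and
  bounded below by 0, so the real-valued \<open>INF\<close> is the genuine infimum.
\<close>

definition path_inf ::
  "'a set \<Rightarrow> ('a \<Rightarrow> 'a \<Rightarrow> real) \<Rightarrow> ('a \<Rightarrow> 'a \<Rightarrow> real) \<Rightarrow> 'a \<Rightarrow> 'a \<Rightarrow> real" where
  "path_inf X \<kappa> \<sigma> x y = (INF p\<in>lists X. path_sum \<kappa> \<sigma> x p y)"

end

theory Submission
  imports Defs
begin

text \<open>
  A path from \<open>x\<close> to \<open>y\<close> with intermediate points \<open>p\<close> extends to a path from \<open>x\<close> to \<open>z\<close>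
  that visits \<open>y\<close> last, and the extension costs exactly \<open>\<sigma> y z\<close> more
  (\<open>path_sum_snoc\<close>). Hence \<open>path_inf X \<kappa> \<sigma> x z - \<sigma> y z\<close> is a lower bound of all path sums
  from \<open>x\<close> to \<open>y\<close>, so it is at most their infimum. Nonnegativity of the kernels bounds the path
  sums below, which makes the infimum over paths to \<open>z\<close> a genuine lower bound.
\<close>

lemma path_sum_snoc: "path_sum \<kappa> \<sigma> x (p @ [y]) z = path_sum \<kappa> \<sigma> x p y + \<sigma> y z"
proof (cases p)
  case Nil
  then show ?thesis by simp
next
  case (Cons x\<^sub>1 q)
  \<comment> \<open>The last term of the longer middle sum is the former final step \<open>\<sigma> (last p) y\<close>.\<close>
  have "(\<Sum>i<Suc (length q). \<sigma> ((p @ [y]) ! i) ((p @ [y]) ! Suc i))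
      = (\<Sum>i<length q. \<sigma> (p ! i) (p ! Suc i)) + \<sigma> (last p) y"
  proof -
    have len: "length p = Suc (length q)" and last: "last p = p ! length q"
      using Cons by (simp_all add: last_conv_nth)
    have "(\<Sum>i<length q. \<sigma> ((p @ [y]) ! i) ((p @ [y]) ! Suc i))
        = (\<Sum>i<length q. \<sigma> (p ! i) (p ! Suc i))"
      by (intro sum.cong) (simp_all add: nth_append len)
    then show ?thesis
      by (simp add: nth_append len last)
  qed
  then show ?thesis using Cons by simp
qed

lemma path_sum_nonneg:
  assumes "\<kappa> \<in> nonneg_kernels X" and "\<sigma> \<in> nonneg_kernels X"
    and "x \<in> X" and "p \<in> lists X" and "y \<in> X"
  shows "0 \<le> path_sum \<kappa> \<sigma> x p y"
  using assms(4,5)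
proof (induction p arbitrary: y rule: rev_induct)
  case Nil
  then show ?case using assms by (simp add: nonneg_kernels_def)
next
  case (snoc w p)
  then show ?case using assms by (simp add: path_sum_snoc nonneg_kernels_def)
qed

lemma path_inf_le_path_sum:
  assumes "\<kappa> \<in> nonneg_kernels X" and "\<sigma> \<in> nonneg_kernels X"
    and "x \<in> X" and "p \<in> lists X" and "y \<in> X"
  shows "path_inf X \<kappa> \<sigma> x y \<le> path_sum \<kappa> \<sigma> x p y"
  unfolding path_inf_def
proof (rule cINF_lower)
  show "bdd_below ((\<lambda>p. path_sum \<kappa> \<sigma> x p y) ` lists X)"
    using path_sum_nonneg[OF assms(1-3) _ assms(5)] by (intro bdd_belowI2)
qed (fact assms(4))

theorem lemma3p1:
  fixes X :: "'a set" and \<kappa> \<sigma> :: "'a \<Rightarrow> 'a \<Rightarrow> real"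
  assumes "\<kappa> \<in> nonneg_kernels X" and "\<sigma> \<in> nonneg_kernels X"
  shows "right_dominated X (path_inf X \<kappa> \<sigma>) \<sigma>"
  unfolding right_dominated_def
proof (intro ballI)
  fix x y z assume xyz: "x \<in> X" "y \<in> X" "z \<in> X"
  have "path_inf X \<kappa> \<sigma> x z - \<sigma> y z \<le> path_sum \<kappa> \<sigma> x p y" if "p \<in> lists X" for p
    using path_inf_le_path_sum[OF assms, of x "p @ [y]" z] xyz that
    by (simp add: path_sum_snoc)
  then have "path_inf X \<kappa> \<sigma> x z - \<sigma> y z \<le> path_inf X \<kappa> \<sigma> x y"
    unfolding path_inf_def[of X \<kappa> \<sigma> x y] by (intro cINF_greatest) auto
  then show "path_inf X \<kappa> \<sigma> x z \<le> path_inf X \<kappa> \<sigma> x y + \<sigma> y z"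
    by simp
qed

end
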